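(* Let $\alpha,\beta>-1$ be real, let $n\in\mathbb N=\{0,1,2,\ldots\}$, and let $D^n_i(x;\alpha,\beta)$ be the dual Bernstein polynomials of degree $n$. For every $i=0,1,\ldots,n$ the following identity of polynomials in $x$ holds: $$(1-x)\frac{\mathrm d}{\mathrm dx}D^n_i(x;\alpha,\beta)-(n-i+\alpha+1)D^n_i(x;\alpha,\beta)=\frac{(i-n)(i+\beta+1)}{i+1}D^n_{i+1}(x;\alpha,\beta)-A^{(\alpha,\beta)}_{ni}\,\frac{n+\alpha+1}{i+1}\,R^{(\alpha,\beta+1)}_n(x).$$
   Context: Pochhammer symbol: $(c)_0:=1$, $(c)_l:=c(c+1)\cdots(c+l-1)$ for $l\ge1$. Inner product: $\langle f,g\rangle_{\alpha,\beta}:=\int_0^1(1-x)^\alpha x^\beta f(x)g(x)\,\mathrm dx$. Bernstein basis polynomials: $B^n_i(x):=\binom{n}{i}x^i(1-x)^{n-i}$, $i=0,\ldots,n$; they form a basis of the space $\Pi_n$ of polynomials of degree at most $n$. Dual Bernstein polynomials of degree $n$: the polynomials $D^n_0(x;\alpha,\beta),\ldots,D^n_n(x;\alpha,\beta)\in\Pi_n$ determined by $\langle B^n_i,D^n_j(\cdot;\alpha,\beta)\rangle_{\alpha,\beta}=\delta_{ij}$ for $i,j=0,\ldots,n$. Convention: $D^n_i(x;\alpha,\beta):=0$ for $i<0$ or $i>n$. Shifted Jacobi polynomials (for parameters $a,b>-1$): $R^{(a,b)}_k(x):=\frac{(a+1)_k}{k!}\sum_{l=0}^{k}\frac{(-k)_l(k+a+b+1)_l}{(a+1)_l\,l!}(1-x)^l$.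 Constants: $\sigma:=\alpha+\beta+1$, $K:=\Gamma(\alpha+1)\Gamma(\beta+1)/\Gamma(\sigma+1)$, and $A^{(\alpha,\beta)}_{ni}:=\dfrac{(-1)^{n-i}(n+1)(\sigma+1)_n}{K\,(\alpha+1)_{n-i}(\beta+1)_i}$. *)

theory Defs
  imports "HOL-Analysis.Analysis" "HOL-Computational_Algebra.Polynomial"
begin

definition jacobi_inner :: "real \<Rightarrow> real \<Rightarrow> (real \<Rightarrow> real) \<Rightarrow> (real \<Rightarrow> real) \<Rightarrow> real" where
  "jacobi_inner \<alpha> \<beta> f g = integral {0..1} (\<lambda>x. (1 - x) powr \<alpha> * x powr \<beta> * f x * g x)"

text \<open>
  The Bernstein basis is \<^const>\<open>Bernstein\<close>. For \<open>\<alpha>, \<beta> > -1\<close> the inner product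
  is positive definite on polynomials, so the description below is satisfied by exactly one
  polynomial; outside that parameter range it may be meaningless.
  Indices are natural numbers, so the convention that the polynomials with index outside
  \<open>0, \<dots>, n\<close> vanish only concerns \<open>i > n\<close>.
\<close>

definition dual_bernstein :: "nat \<Rightarrow> real \<Rightarrow> real \<Rightarrow> nat \<Rightarrow> real poly" where
  "dual_bernstein n \<alpha> \<beta> i =
     (if i \<le> n
      then (THE p. degree p \<le> n \<and>
              (\<forall>k\<le>n. jacobi_inner \<alpha> \<beta> (Bernstein n k) (poly p) = (if k = i then 1 else 0)))
      else 0)"

definition shifted_jacobi :: "nat \<Rightarrow> real \<Rightarrow> real \<Rightarrow> real poly" where
  "shifted_jacobi k a b =
     smult (pochhammer (a + 1) k / fact k)
       (\<Sum>l\<le>k. smult (pochhammer (- real k) l * pochhammer (real k + a + b + 1) l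
                        / (pochhammer (a + 1) l * fact l))
                 ([:1, -1:] ^ l))"

definition jacobi_K :: "real \<Rightarrow> real \<Rightarrow> real" where
  "jacobi_K \<alpha> \<beta> = Gamma (\<alpha> + 1) * Gamma (\<beta> + 1) / Gamma ((\<alpha> + \<beta> + 1) + 1)"

definition coeff_A :: "real \<Rightarrow> real \<Rightarrow> nat \<Rightarrow> nat \<Rightarrow> real" where
  "coeff_A \<alpha> \<beta> n i =
     (-1) ^ (n - i) * (real n + 1) * pochhammer ((\<alpha> + \<beta> + 1) + 1) n
       / (jacobi_K \<alpha> \<beta> * pochhammer (\<alpha> + 1) (n - i) * pochhammer (\<beta> + 1) i)"

end

theory Submission
  imports Defs
begin

text \<open>
  Let \<open>P\<close> be the difference of the two sides. For \<open>1 \<le> k \<le> n\<close> integration by parts shows that \<open>P\<close> is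
  orthogonal to \<open>x\<^sup>k (1 - x)\<^bsup>n-k\<^esup>\<close>; the boundary terms vanish because of the factor \<open>x\<close>, and the
  Jacobi polynomial with parameters \<open>\<alpha>\<close>, \<open>\<beta> + 1\<close> is orthogonal to these polynomials as well.
  Moreover \<open>P(1) = 0\<close>: the values of the dual Bernstein polynomials at \<open>1\<close> are, up to a common
  factor, the Bernstein coefficients of the polynomial that represents the evaluation at \<open>1\<close>.
  Hence \<open>P = (1 - x) Q\<close>, and testing \<open>P\<close> with \<open>x Q\<close> gives \<open>\<integral> x (1 - x) Q\<^sup>2 = 0\<close> with respect to
  the Jacobi weight, so \<open>Q = 0\<close>.
\<close>

section \<open>A terminating hypergeometric sum\<close>

text \<open>Chu-Vandermonde: splitting \<open>pochhammer c (k + m)\<close> at \<open>m\<close> turns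
  the sum into a terminating 2F1 at 1. The factor \<open>pochhammer (- real m) n\<close> vanishes
  for m < n; both the orthogonality of the Jacobi polynomial and that of \<open>S n\<close> rest on
  this.\<close>

lemma pochhammer_quotient_sum:
  fixes c :: real
  assumes "c > 0"
  shows "(\<Sum>k\<le>n. pochhammer (- real n) k / fact k * (pochhammer c (k + m) / pochhammer c k))
           = pochhammer c m * pochhammer (- real m) n / pochhammer c n"
proof -
  have "(\<Sum>k\<le>n. pochhammer (- real n) k / fact k * (pochhammer c (k + m) / pochhammer c k))
      = (\<Sum>k = 0..n. pochhammer c m *
           (pochhammer (c + real m) k * pochhammer (- real n) k / (fact k * pochhammer c k)))"
    unfolding atMost_atLeast0
  proof (intro sum.cong refl)
    fix k
    have "pochhammer c (k + m) = pochhammer c m * pochhammer (c + real m) k"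
      using pochhammer_product'[of c m k] by (simp add: add.commute)
    then show "pochhammer (- real n) k / fact k * (pochhammer c (k + m) / pochhammer c k) = pochhammer c m *
           (pochhammer (c + real m) k * pochhammer (- real n) k / (fact k * pochhammer c k))"
      by simp
  qed
  also have "\<dots> = pochhammer c m *
      (\<Sum>k = 0..n. pochhammer (c + real m) k * pochhammer (- real n) k / (of_nat (fact k) * pochhammer c k))"
    by (simp add: sum_distrib_left)
  also have "\<dots> = pochhammer c m * (pochhammer (c - (c + real m)) n / pochhammer c n)"
    using assms by (subst Vandermonde_pochhammer) auto
  finally show ?thesis by simp
qed

section \<open>The Bernstein basis without its binomial factors\<close>

lemma degree_linear_powers_le:
  fixes a b :: "real poly"
  assumes "degree a \<le> 1" "degree b \<le> 1" "j + k \<le> n"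
  shows "degree (a ^ j * b ^ k) \<le> n"
proof -
  have "degree (a ^ j * b ^ k) \<le> degree (a ^ j) + degree (b ^ k)"
    by (rule degree_mult_le)
  also have "\<dots> \<le> degree a * j + degree b * k"
    by (intro add_mono degree_power_le)
  also have "\<dots> \<le> 1 * j + 1 * k"
    using assms by (intro add_mono mult_right_mono) auto
  finally show ?thesis using assms by simp
qed

text \<open>Induction on n: subtracting \<open>poly p 0\<close> times (1 - x)^(n+1) leaves a
  multiple of x, and the quotient by x has degree at most n.\<close>

lemma bernstein_span:
  fixes p :: "real poly"
  assumes "degree p \<le> n"
  shows "\<exists>c. p = (\<Sum>k\<le>n. smult (c k) ([:0, 1:] ^ k * [:1, -1:] ^ (n - k)))"
  using assms
proof (induction n arbitrary: p)
  case 0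
  then obtain a where "p = [:a:]" by (metis degree_0_id le_zero_eq degree_eq_zeroE)
  then show ?case by (intro exI[of _ "\<lambda>_. a"]) simp
next
  case (Suc n)
  define r where "r = p - smult (poly p 0) ([:1, -1:] ^ Suc n)"
  have "poly r 0 = 0" by (simp add: r_def)
  then have "[:0, 1:] dvd r" by (metis dvd_iff_poly_eq_0 minus_zero)
  then obtain q where q: "r = [:0, 1:] * q" by (elim dvdE)
  have "degree r \<le> Suc n"
    unfolding r_def
    using Suc.prems degree_linear_powers_le[of "[:0,1:]" "[:1,-1:]" 0 "Suc n" "Suc n"]
    by (intro degree_diff_le order.trans[OF degree_smult_le]) auto
  then have "degree q \<le> n"
    by (cases "q = 0") (auto simp: q)
  then obtain c where c: "q = (\<Sum>k\<le>n. smult (c k) ([:0, 1:] ^ k * [:1, -1:] ^ (n - k)))"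
    using Suc.IH by blast
  have "p = smult (poly p 0) ([:1, -1:] ^ Suc n) + [:0, 1:] * q"
    using q by (simp add: r_def)
  also have "\<dots> = (\<Sum>k\<le>Suc n. smult (case k of 0 \<Rightarrow> poly p 0 | Suc j \<Rightarrow> c j)
                     ([:0, 1:] ^ k * [:1, -1:] ^ (Suc n - k)))"
    unfolding sum.atMost_Suc_shift c
    by (simp add: sum_distrib_left mult.assoc del: mult_pCons_left mult_pCons_right)
  finally show ?case by blast
qed

text \<open>The same peeling: at x = 0 only the term with k = 0 survives, so \<open>c 0\<close>
  vanishes, and the rest can be divided by x.\<close>

lemma bernstein_independent:
  fixes c :: "nat \<Rightarrow> real"
  assumes "(\<Sum>k\<le>n. smult (c k) ([:0, 1:] ^ k * [:1, -1:] ^ (n - k))) = 0" "k \<le> n"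
  shows "c k = 0"
  using assms
proof (induction n arbitrary: c k)
  case 0
  then show ?case by simp
next
  case (Suc n)
  have split: "(\<Sum>k\<le>Suc n. smult (c k) ([:0, 1:] ^ k * [:1, -1:] ^ (Suc n - k)))
      = smult (c 0) ([:1, -1:] ^ Suc n)
        + [:0, 1:] * (\<Sum>k\<le>n. smult (c (Suc k)) ([:0, 1:] ^ k * [:1, -1:] ^ (n - k)))"
    unfolding sum.atMost_Suc_shift
    by (simp add: sum_distrib_left mult.assoc del: mult_pCons_left mult_pCons_right)
  have "poly (\<Sum>k\<le>Suc n. smult (c k) ([:0, 1:] ^ k * [:1, -1:] ^ (Suc n - k))) 0 = 0"
    using Suc.prems(1) by simp
  then have c0: "c 0 = 0"
    unfolding split by simp
  have "[:0, 1:] * (\<Sum>k\<le>n. smult (c (Suc k)) ([:0, 1:] ^ k * [:1, -1:] ^ (n - k))) = 0"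
    using Suc.prems(1) c0 unfolding split by simp
  then have "(\<Sum>k\<le>n. smult (c (Suc k)) ([:0, 1:] ^ k * [:1, -1:] ^ (n - k))) = 0"
    unfolding mult_eq_0_iff by auto
  then show ?case
    using Suc.IH[of "\<lambda>k. c (Suc k)"] c0 Suc.prems(2) by (cases k) auto
qed

section \<open>Dual families of linear functionals\<close>

text \<open>A Gram-Schmidt style induction on the number of functionals, which avoids any count of
  dimensions. It supplies the existence half of the definite description behind
  \<open>dual_bernstein\<close>.\<close>

lemma dual_family_exists:
  fixes f :: "nat \<Rightarrow> real poly \<Rightarrow> real" and V :: "real poly set"
  assumes V0: "0 \<in> V"
    and V_add: "\<And>p q. p \<in> V \<Longrightarrow> q \<in> V \<Longrightarrow> p + q \<in> V"
    and V_smult: "\<And>a p. p \<in> V \<Longrightarrow> smult a p \<in> V"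
    and f_add: "\<And>k p q. f k (p + q) = f k p + f k q"
    and f_smult: "\<And>k a p. f k (smult a p) = a * f k p"
    and indep: "\<And>c. (\<And>p. p \<in> V \<Longrightarrow> (\<Sum>k<n. c k * f k p) = 0) \<Longrightarrow> (\<And>k. k < n \<Longrightarrow> c k = 0)"
  shows "\<exists>d. \<forall>i<n. d i \<in> V \<and> (\<forall>k<n. f k (d i) = (if k = i then 1 else 0))"
  using indep
proof (induction n)
  case 0
  then show ?case by simp
next
  case (Suc n)
  have V_sum: "(\<Sum>j<m. g j) \<in> V" if "\<And>j. j < m \<Longrightarrow> g j \<in> V" for g :: "nat \<Rightarrow> real poly" and m
    using that by (induction m) (auto intro: V0 V_add)
  have f_0: "f k 0 = 0" for k
    using f_smult[of k 0 0] by simp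
  have f_sum: "f k (\<Sum>j<m. g j) = (\<Sum>j<m. f k (g j))" for k g and m :: nat
    by (induction m) (auto simp: f_0 f_add)
  have f_diff: "f k (p - q) = f k p - f k q" for k p q
    using f_add[of k p "smult (-1) q"] f_smult[of k "-1" q] by simp
  have V_diff: "p - q \<in> V" if "p \<in> V" "q \<in> V" for p q
    using V_add[of p "smult (-1) q"] V_smult[of q "-1"] that by simp
  have "\<exists>d. \<forall>i<n. d i \<in> V \<and> (\<forall>k<n. f k (d i) = (if k = i then 1 else 0))"
  proof (rule Suc.IH)
    fix c :: "nat \<Rightarrow> real" and k
    assume *: "\<And>p. p \<in> V \<Longrightarrow> (\<Sum>k<n. c k * f k p) = 0" and k: "k < n"
    have "(\<Sum>k<Suc n. (c(n := 0)) k * f k p) = 0" if "p \<in> V" for p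
      using *[OF that] by simp
    from Suc.prems[OF this, of k] k show "c k = 0" by simp
  qed
  then obtain d where d: "\<And>i. i < n \<Longrightarrow> d i \<in> V"
      "\<And>i k. i < n \<Longrightarrow> k < n \<Longrightarrow> f k (d i) = (if k = i then 1 else 0)"
    by blast
  \<comment> \<open>Otherwise \<open>f n\<close> would agree on V with a combination of the earlier
    functionals, a dependence whose coefficient at n is 1.\<close>
  have "\<exists>v\<in>V. f n v \<noteq> (\<Sum>k<n. f n (d k) * f k v)"
  proof (rule ccontr)
    assume "\<not> ?thesis"
    then have "f n v = (\<Sum>k<n. f n (d k) * f k v)" if "v \<in> V" for v
      using that by metis
    then have "(\<Sum>k<Suc n. ((\<lambda>k. - f n (d k))(n := 1)) k * f k v) = 0" if "v \<in> V" for v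
      using that by (simp add: sum_negf)
    from Suc.prems[OF this, of n] show False by simp
  qed
  then obtain v where v: "v \<in> V" "f n v \<noteq> (\<Sum>k<n. f n (d k) * f k v)"
    by blast
  \<comment> \<open>Subtracting the projection of v onto the earlier dual vectors kills
    \<open>f k\<close> for k < n, while the choice of v keeps \<open>f n w\<close> nonzero; u is w
    scaled to \<open>f n u = 1\<close>.\<close>
  define w where "w = v - (\<Sum>k<n. smult (f k v) (d k))"
  define u where "u = smult (1 / f n w) w"
  have w: "w \<in> V" "\<And>k. k < n \<Longrightarrow> f k w = 0" "f n w \<noteq> 0"
  proof -
    show "w \<in> V" unfolding w_def by (intro V_diff V_sum V_smult v d)
    show "f k w = 0" if "k < n" for k
      using that by (simp add: w_def f_diff f_sum f_smult d if_distrib cong: if_cong)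
    show "f n w \<noteq> 0" using v(2) by (simp add: w_def f_diff f_sum f_smult mult.commute)
  qed
  have u: "u \<in> V" "\<And>k. k < n \<Longrightarrow> f k u = 0" "f n u = 1"
    using w by (auto simp: u_def f_smult V_smult)
  show ?case
  proof (intro exI allI impI conjI)
    fix i assume i: "i < Suc n"
    \<comment> \<open>The vector u is the new member; the old ones are corrected by multiples of u,
      which makes \<open>f n\<close> vanish on them and leaves the earlier functionals
      unchanged.\<close>
    let ?d = "\<lambda>i. if i = n then u else d i - smult (f n (d i)) u"
    show "?d i \<in> V" using i u d by (auto intro: V_diff V_smult)
    fix k assume "k < Suc n"
    then show "f k (?d i) = (if k = i then 1 else 0)"
      using i u d by (auto simp: f_diff f_smult less_Suc_eq)
  qed
qed

section \<open>The Jacobi weight and its moments\<close>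

locale jacobi_weight =
  fixes \<alpha> \<beta> :: real
  assumes \<alpha>: "\<alpha> > -1" and \<beta>: "\<beta> > -1"
begin

definition w :: "real \<Rightarrow> real" where
  "w x = (1 - x) powr \<alpha> * x powr \<beta>"

text \<open>As a functional on \<open>real poly\<close>, it turns pairings into values at products,
  so that they can be handled by ring identities.\<close>

definition L :: "real poly \<Rightarrow> real" where
  "L p = integral {0..1} (\<lambda>x. w x * poly p x)"

abbreviation X :: "real poly" where "X \<equiv> [:0, 1:]"
abbreviation Y :: "real poly" where "Y \<equiv> [:1, -1:]"

definition K :: real where "K = jacobi_K \<alpha> \<beta>"

lemma K_pos: "K > 0"
  using \<alpha> \<beta> by (simp add: K_def jacobi_K_def Gamma_real_pos)

text \<open>This is the Beta integral; quotients of Gamma values at arguments that differ by an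
  integer become Pochhammer symbols.\<close>

lemma moment_has_integral:
  "((\<lambda>x. w x * poly (X ^ j * Y ^ k) x) has_integral
      K * pochhammer (\<beta> + 1) j * pochhammer (\<alpha> + 1) k / pochhammer (\<alpha> + \<beta> + 2) (j + k)) {0..1}"
proof -
  have np: "\<beta> + 1 \<notin> \<int>\<^sub>\<le>\<^sub>0" "\<alpha> + 1 \<notin> \<int>\<^sub>\<le>\<^sub>0" "\<alpha> + \<beta> + 2 \<notin> \<int>\<^sub>\<le>\<^sub>0"
    using \<alpha> \<beta> by (auto elim!: nonpos_Ints_cases)
  have G: "Gamma (\<beta> + 1) > 0" "Gamma (\<alpha> + 1) > 0" "Gamma (\<alpha> + \<beta> + 2) > 0"
    using \<alpha> \<beta> by (auto intro!: Gamma_real_pos)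
  have "((\<lambda>x. x powr (\<beta> + 1 + real j - 1) * (1 - x) powr (\<alpha> + 1 + real k - 1)) has_integral
          Beta (\<beta> + 1 + real j) (\<alpha> + 1 + real k)) {0..1}"
    using \<alpha> \<beta> by (intro has_integral_Beta_real) auto
  \<comment> \<open>Turning \<open>powr\<close> into a natural power needs a positive base
    (\<open>0 powr 0\<close> is 0), so the comparison is made on the open interval; the end points
    do not affect the integral.\<close>
  moreover have "x powr (\<beta> + 1 + real j - 1) * (1 - x) powr (\<alpha> + 1 + real k - 1)
                   = w x * poly (X ^ j * Y ^ k) x" if "x \<in> {0<..<1}" for x
    using that by (simp add: w_def powr_add powr_realpow mult_ac)
  ultimately have "((\<lambda>x. w x * poly (X ^ j * Y ^ k) x) has_integral
          Beta (\<beta> + 1 + real j) (\<alpha> + 1 + real k)) {0..1}"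
    unfolding has_integral_Icc_iff_Ioo by (subst has_integral_cong) auto
  also have "Beta (\<beta> + 1 + real j) (\<alpha> + 1 + real k)
      = K * pochhammer (\<beta> + 1) j * pochhammer (\<alpha> + 1) k / pochhammer (\<alpha> + \<beta> + 2) (j + k)"
  proof -
    have "\<beta> + 1 + real j + (\<alpha> + 1 + real k) = \<alpha> + \<beta> + 2 + real (j + k)" "\<alpha> + \<beta> + 1 + 1 = \<alpha> + \<beta> + 2"
      by simp_all
    then show ?thesis
      unfolding Beta_def K_def jacobi_K_def pochhammer_Gamma[OF np(1)]
        pochhammer_Gamma[OF np(2)] pochhammer_Gamma[OF np(3)]
      using G by (simp only:) simp
  qed
  finally show ?thesis .
qed

lemma integrable: "(\<lambda>x. w x * poly p x) integrable_on {0..1}"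
proof -
  have "(\<lambda>x. \<Sum>i\<le>degree p. coeff p i * (w x * poly (X ^ i * Y ^ 0) x)) integrable_on {0..1}"
    by (intro integrable_sum integrable_on_mult_right has_integral_integrable[OF moment_has_integral]) simp
  also have "(\<lambda>x. \<Sum>i\<le>degree p. coeff p i * (w x * poly (X ^ i * Y ^ 0) x))
               = (\<lambda>x. w x * poly p x)"
    unfolding poly_altdef[of p] by (simp add: sum_distrib_left mult_ac)
  finally show ?thesis .
qed

lemma L_add: "L (p + q) = L p + L q"
  unfolding L_def poly_add distrib_left by (rule integral_add[OF integrable integrable])

lemma L_smult: "L (smult a p) = a * L p"
  unfolding L_def by (simp add: mult.left_commute)

lemma L_0 [simp]: "L 0 = 0"
  by (simp add: L_def)

lemma L_diff: "L (p - q) = L p - L q"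
  using L_add[of p "smult (-1) q"] L_smult[of "-1" q] by simp

lemma L_sum: "L (\<Sum>i\<in>A. f i) = (\<Sum>i\<in>A. L (f i))"
  by (induction A rule: infinite_finite_induct) (auto simp: L_add)

lemma L_moment:
  "L (X ^ j * Y ^ k) =
     K * pochhammer (\<beta> + 1) j * pochhammer (\<alpha> + 1) k / pochhammer (\<alpha> + \<beta> + 2) (j + k)"
  unfolding L_def by (rule integral_unique[OF moment_has_integral])

section \<open>Positivity and definiteness\<close>

lemma L_mono:
  assumes "\<And>x. 0 \<le> x \<Longrightarrow> x \<le> 1 \<Longrightarrow> poly p x \<le> poly q x"
  shows "L p \<le> L q"
  unfolding L_def using assms
  by (intro integral_le integrable) (auto simp: w_def intro!: mult_left_mono)

text \<open>The factor \<open>x(1 - x)\<close> makes the integrand continuous at the end points.\<close>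

lemma L_square_eq_0:
  assumes "L (X * Y * (p * p)) = 0"
  shows "p = 0"
proof -
  let ?g = "\<lambda>x. (1 - x) powr (\<alpha> + 1) * x powr (\<beta> + 1) * (poly p x)\<^sup>2"
  have "continuous_on {0..1} (\<lambda>x::real. x powr (\<beta> + 1))" "continuous_on {0..1} (\<lambda>x. (1 - x) powr (\<alpha> + 1))"
    using \<alpha> \<beta> by (intro continuous_on_powr' continuous_intros; simp)+
  then have cont: "continuous_on {0..1} ?g"
    by (intro continuous_on_mult continuous_on_power continuous_on_poly continuous_on_id)
  have "w x * poly (X * Y * (p * p)) x = ?g x" if "x \<in> {0..1}" for x
    using that by (cases "x = 0 \<or> x = 1") (auto simp: w_def powr_add power2_eq_square algebra_simps)
  then have "integral {0..1} ?g = 0"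
    using assms unfolding L_def by (metis (no_types, lifting) integral_cong)
  then have zero: "\<forall>x\<in>{0..1}. ?g x = 0"
    by (subst (asm) integral_eq_0_iff[OF cont]) auto
  have "{0<..<1} \<subseteq> {x. poly p x = 0}"
  proof
    fix x :: real assume "x \<in> {0<..<1}"
    with zero[rule_format, of x] show "x \<in> {x. poly p x = 0}" by simp
  qed
  moreover have "infinite {0<..<1::real}" by simp
  ultimately have "infinite {x. poly p x = 0}" using finite_subset by blast
  then show ?thesis using poly_roots_finite by blast
qed

text \<open>For a negative exponent the weight is unbounded near an end point. The bounds 0 \<le>
  x(1 - x)p^2 \<le> p^2 on [0,1] reduce the claim to the integrand with the extra factor x(1 -
  x).\<close>

lemma L_definite:
  assumes "L (p * p) = 0"
  shows "p = 0"
proof (rule L_square_eq_0)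
  have "L (X * Y * (p * p)) \<le> L (p * p)"
  proof (rule L_mono)
    fix x :: real assume x: "0 \<le> x" "x \<le> 1"
    have "x * (1 - x) * (poly p x)\<^sup>2 \<le> 1 * (poly p x)\<^sup>2"
      using x by (intro mult_right_mono mult_le_one) auto
    then show "poly (X * Y * (p * p)) x \<le> poly (p * p) x"
      by (simp add: power2_eq_square algebra_simps)
  qed
  moreover have "L 0 \<le> L (X * Y * (p * p))"
  proof (rule L_mono)
    fix x :: real assume "0 \<le> x" "x \<le> 1"
    then have "0 \<le> x * (1 - x) * (poly p x)\<^sup>2" by simp
    then show "poly 0 x \<le> poly (X * Y * (p * p)) x"
      by (simp add: power2_eq_square algebra_simps)
  qed
  ultimately show "L (X * Y * (p * p)) = 0" using assms by simp
qed

text \<open>Integration by parts; the factor \<open>x\<close> removes the boundary term at \<open>0\<close>.\<close>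

lemma L_pderiv:
  "L (X ^ Suc k * Y ^ Suc m * pderiv p)
     = (\<alpha> + 1 + real m) * L (X ^ Suc k * Y ^ m * p)
       - (\<beta> + 1 + real k) * L (X ^ k * Y ^ Suc m * p)"
proof -
  \<comment> \<open>By linearity it suffices to take p = x^j. All three terms are then moments with
    a common factor, and the claim becomes j = (\<beta> + 1 + k + j) - (\<beta> + 1 + k).\<close>
  have monomial: "L (X ^ Suc k * Y ^ Suc m * pderiv (X ^ j))
     = (\<alpha> + 1 + real m) * L (X ^ Suc k * Y ^ m * X ^ j)
       - (\<beta> + 1 + real k) * L (X ^ k * Y ^ Suc m * X ^ j)" for j
  proof -
    have "X ^ Suc k * Y ^ Suc m * pderiv (X ^ j) = smult (real j) (X ^ (k + j) * Y ^ Suc m)"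
    proof (cases j)
      case (Suc i)
      have "pderiv (X ^ Suc i) = smult (real (Suc i)) (X ^ i)"
        by (simp only: pderiv_power_Suc) (simp add: pderiv_pCons)
      then show ?thesis unfolding Suc
        by (simp add: power_add mult_ac del: mult_pCons_left mult_pCons_right)
    qed (simp add: pderiv_1)
    then have 1: "L (X ^ Suc k * Y ^ Suc m * pderiv (X ^ j)) = real j * L (X ^ (k + j) * Y ^ Suc m)"
      by (simp only: L_smult)
    have 2: "X ^ Suc k * Y ^ m * X ^ j = X ^ Suc (k + j) * Y ^ m"
            "X ^ k * Y ^ Suc m * X ^ j = X ^ (k + j) * Y ^ Suc m"
      by (simp_all add: power_add mult_ac del: mult_pCons_left mult_pCons_right)
    show ?thesis
      unfolding 1 2 L_moment
    proof -
      let ?c = "\<lambda>P. K * pochhammer (\<beta> + 1) (k + j) * pochhammer (\<alpha> + 1) m * (\<alpha> + 1 + real m) * P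
                 / pochhammer (\<alpha> + \<beta> + 2) (Suc (k + j + m))"
      have "?c (real j) = ?c (\<beta> + 1 + real (k + j)) - ?c (\<beta> + 1 + real k)"
        by (simp add: diff_divide_distrib[symmetric] right_diff_distrib[symmetric])
      then show "real j * (K * pochhammer (\<beta> + 1) (k + j) * pochhammer (\<alpha> + 1) (Suc m)
          / pochhammer (\<alpha> + \<beta> + 2) (k + j + Suc m))
        = (\<alpha> + 1 + real m) * (K * pochhammer (\<beta> + 1) (Suc (k + j)) * pochhammer (\<alpha> + 1) m
            / pochhammer (\<alpha> + \<beta> + 2) (Suc (k + j) + m))
          - (\<beta> + 1 + real k) * (K * pochhammer (\<beta> + 1) (k + j) * pochhammer (\<alpha> + 1) (Suc m)
            / pochhammer (\<alpha> + \<beta> + 2) (k + j + Suc m))"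
        unfolding pochhammer_Suc[of "\<beta> + 1"] pochhammer_Suc[of "\<alpha> + 1"] add_Suc add_Suc_right
        by (simp only: times_divide_eq_right mult_ac)
    qed
  qed
  have p: "p = (\<Sum>j\<le>degree p. smult (coeff p j) (X ^ j))"
    using poly_as_sum_of_monoms[of p] by (simp add: monom_altdef)
  have L_mult: "L (q * p) = (\<Sum>j\<le>degree p. coeff p j * L (q * X ^ j))" for q
  proof -
    have "L (q * p) = L (q * (\<Sum>j\<le>degree p. smult (coeff p j) (X ^ j)))"
      by (rule arg_cong[OF p])
    then show ?thesis
      by (simp only: sum_distrib_left mult_smult_right L_sum L_smult)
  qed
  have "pderiv p = pderiv (\<Sum>j\<le>degree p. smult (coeff p j) (X ^ j))"
    by (rule arg_cong[OF p])
  also have "\<dots> = (\<Sum>j\<le>degree p. smult (coeff p j) (pderiv (X ^ j)))"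
  proof -
    have "pderiv (\<Sum>j\<in>A. g j) = (\<Sum>j\<in>A. pderiv (g j))" for A :: "nat set" and g :: "nat \<Rightarrow> real poly"
      by (induction A rule: infinite_finite_induct) (simp_all add: pderiv_add)
    then show ?thesis by (simp only: pderiv_smult)
  qed
  finally have D: "pderiv p = (\<Sum>j\<le>degree p. smult (coeff p j) (pderiv (X ^ j)))" .
  have L_mult_pderiv: "L (q * pderiv p) = (\<Sum>j\<le>degree p. coeff p j * L (q * pderiv (X ^ j)))" for q
    unfolding D sum_distrib_left mult_smult_right L_sum L_smult ..
  show ?thesis
    unfolding L_mult L_mult_pderiv monomial right_diff_distrib sum_subtractf sum_distrib_left
    by (simp only: mult.left_commute[of _ "coeff p _"])
qed

section \<open>Criteria for a polynomial to vanish\<close>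

text \<open>Since p is itself a combination of the test polynomials, \<open>L (p * p)\<close> is
  0.\<close>

lemma orthogonal_imp_0:
  assumes "degree p \<le> n" "\<And>k. k \<le> n \<Longrightarrow> L (X ^ k * Y ^ (n - k) * p) = 0"
  shows "p = 0"
proof (rule L_definite)
  obtain c where c: "p = (\<Sum>k\<le>n. smult (c k) (X ^ k * Y ^ (n - k)))"
    using bernstein_span[OF assms(1)] by blast
  have "L (p * p) = L ((\<Sum>k\<le>n. smult (c k) (X ^ k * Y ^ (n - k))) * p)"
    by (rule arg_cong[OF c])
  also have "\<dots> = 0"
    unfolding sum_distrib_right mult_smult_left L_sum L_smult
    by (intro sum.neutral ballI) (simp only: assms(2) atMost_iff mult_zero_right)
  finally show "L (p * p) = 0" .
qed

text \<open>The condition at 1 replaces the missing test polynomial (1 - x)^n.\<close>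

lemma orthogonal_vanishing_imp_0:
  assumes deg: "degree p \<le> n" and "poly p 1 = 0"
    and orth: "\<And>k. k < n \<Longrightarrow> L (X ^ Suc k * Y ^ (n - Suc k) * p) = 0"
  shows "p = 0"
proof (rule ccontr)
  assume "p \<noteq> 0"
  have "[:-1, 1:] dvd p" using \<open>poly p 1 = 0\<close> by (simp only: poly_eq_0_iff_dvd)
  then obtain r where "p = [:-1, 1:] * r" by (elim dvdE)
  then have q: "p = Y * - r" by simp
  define q where "q = - r"
  have pq: "p = Y * q" using q by (simp only: q_def)
  then have "q \<noteq> 0" using \<open>p \<noteq> 0\<close> by auto
  then have "degree p = Suc (degree q)" unfolding pq by (subst degree_mult_eq) auto
  \<comment> \<open>The quotient q has degree at most m = n - 1, so x q lies in the span of x^(k+1)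
    (1 - x)^(m-k) for k \<le> m, which are exactly the available test polynomials.\<close>
  then obtain m where n: "n = Suc m" and "degree q \<le> m"
    using deg by (cases n) auto
  then obtain c where c: "q = (\<Sum>k\<le>m. smult (c k) (X ^ k * Y ^ (m - k)))"
    using bernstein_span by blast
  have "X * Y * (q * q) = X * q * p"
    unfolding pq by (simp only: mult_ac)
  also have "\<dots> = X * (\<Sum>k\<le>m. smult (c k) (X ^ k * Y ^ (m - k))) * p"
    by (rule arg_cong[OF c])
  also have "\<dots> = (\<Sum>k\<le>m. smult (c k) (X ^ Suc k * Y ^ (n - Suc k) * p))"
    unfolding n by (simp only: sum_distrib_left sum_distrib_right mult_smult_left mult_smult_right
        power_Suc mult.assoc diff_Suc_Suc)
  finally have "L (X * Y * (q * q)) = (\<Sum>k\<le>m. c k * L (X ^ Suc k * Y ^ (n - Suc k) * p))"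
    by (simp only: L_sum L_smult)
  also have "\<dots> = 0"
    using orth by (intro sum.neutral) (auto simp: n less_Suc_eq_le simp del: mult_pCons_left mult_pCons_right power_Suc)
  finally show False using L_square_eq_0 \<open>q \<noteq> 0\<close> by blast
qed

section \<open>Existence and uniqueness of the dual Bernstein polynomials\<close>

lemma jacobi_inner_Bernstein:
  "jacobi_inner \<alpha> \<beta> (Bernstein n k) (poly p) = real (n choose k) * L (X ^ k * Y ^ (n - k) * p)"
  unfolding jacobi_inner_def L_def integral_mult_right[symmetric]
  by (simp add: Bernstein_def w_def mult_ac)

text \<open>The definite description is resolved here: existence comes from
  \<open>dual_family_exists\<close>, uniqueness from \<open>orthogonal_imp_0\<close>. Testing with
  bare x^k (1 - x)^(n-k) moves the binomial factor into the value
  \<open>1 / real (n choose i)\<close>.\<close>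

lemma dual_bernstein:
  assumes "i \<le> n"
  shows degree_dual_bernstein: "degree (dual_bernstein n \<alpha> \<beta> i) \<le> n"
    and L_dual_bernstein: "\<And>k. k \<le> n \<Longrightarrow>
      L (X ^ k * Y ^ (n - k) * dual_bernstein n \<alpha> \<beta> i) = (if k = i then 1 / real (n choose i) else 0)"
proof -
  let ?V = "{p :: real poly. degree p \<le> n}"
  let ?f = "\<lambda>k p. jacobi_inner \<alpha> \<beta> (Bernstein n k) (poly p)"
  let ?P = "\<lambda>p. degree p \<le> n \<and> (\<forall>k\<le>n. ?f k p = (if k = i then 1 else 0))"
  have f_add: "?f k (p + q) = ?f k p + ?f k q" for k p q
    unfolding jacobi_inner_Bernstein distrib_left[of "_ ^ _ * _ ^ _"] L_add distrib_left ..
  have f_smult: "?f k (smult a p) = a * ?f k p" for k a p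
    unfolding jacobi_inner_Bernstein mult_smult_right L_smult by (rule mult.left_commute)
  have "\<exists>d. \<forall>i<Suc n. d i \<in> ?V \<and> (\<forall>k<Suc n. ?f k (d i) = (if k = i then 1 else 0))"
  proof (rule dual_family_exists)
    fix c :: "nat \<Rightarrow> real" and k
    assume *: "\<And>p. p \<in> ?V \<Longrightarrow> (\<Sum>k<Suc n. c k * ?f k p) = 0" and k: "k < Suc n"
    \<comment> \<open>A linear relation among the functionals, evaluated at the combination q of
      Bernstein polynomials with the same coefficients, reads \<open>L (q * q) = 0\<close>.\<close>
    define q where "q = (\<Sum>k\<le>n. smult (c k * real (n choose k)) (X ^ k * Y ^ (n - k)))"
    have "degree q \<le> n"
      unfolding q_def
      by (intro degree_sum_le order.trans[OF degree_smult_le] degree_linear_powers_le) auto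
    then have "0 = (\<Sum>k\<le>n. c k * ?f k q)"
      using *[of q] by (simp only: mem_Collect_eq lessThan_Suc_atMost)
    also have "\<dots> = L ((\<Sum>k\<le>n. smult (c k * real (n choose k)) (X ^ k * Y ^ (n - k))) * q)"
      unfolding sum_distrib_right mult_smult_left L_sum L_smult jacobi_inner_Bernstein
      by (simp only: mult.assoc)
    also have "\<dots> = L (q * q)" unfolding q_def ..
    finally have "q = 0" using L_definite by metis
    then have "c k * real (n choose k) = 0"
      unfolding q_def by (rule bernstein_independent) (use k in simp)
    then show "c k = 0" using k by simp
  qed (rule f_add f_smult | force intro: degree_add_le order.trans[OF degree_smult_le])+
  then obtain d where "?P d"
    using assms by (auto simp: less_Suc_eq_le)
  moreover have "p = d" if "?P p" for p
  proof -
    have "p - d = 0"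
    proof (rule orthogonal_imp_0)
      show "degree (p - d) \<le> n" using that \<open>?P d\<close> by (intro degree_diff_le) auto
      fix k assume "k \<le> n"
      then have "real (n choose k) * L (X ^ k * Y ^ (n - k) * p) = real (n choose k) * L (X ^ k * Y ^ (n - k) * d)"
        using that \<open>?P d\<close> by (simp only: jacobi_inner_Bernstein)
      then show "L (X ^ k * Y ^ (n - k) * (p - d)) = 0"
        unfolding right_diff_distrib[of "_ ^ _ * _ ^ _"] L_diff using \<open>k \<le> n\<close> by simp
    qed
    then show ?thesis by simp
  qed
  ultimately have "?P (THE p. ?P p)" by (rule theI)
  then have D: "?P (dual_bernstein n \<alpha> \<beta> i)"
    unfolding dual_bernstein_def if_P[OF assms] .
  then show "degree (dual_bernstein n \<alpha> \<beta> i) \<le> n" by blast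
  fix k assume k: "k \<le> n"
  then have "real (n choose k) * L (X ^ k * Y ^ (n - k) * dual_bernstein n \<alpha> \<beta> i) = (if k = i then 1 else 0)"
    using D by (simp only: jacobi_inner_Bernstein)
  then show "L (X ^ k * Y ^ (n - k) * dual_bernstein n \<alpha> \<beta> i) = (if k = i then 1 / real (n choose i) else 0)"
    using k by (auto simp: field_simps split: if_splits)
qed

section \<open>The shifted Jacobi polynomial tested against the Bernstein basis\<close>

lemma poly_shifted_jacobi_1: "poly (shifted_jacobi n \<alpha> b) 1 = pochhammer (\<alpha> + 1) n / fact n"
proof -
  have "(\<Sum>l\<le>n. g l * 0 ^ l) = g 0" for g :: "nat \<Rightarrow> real"
    by (simp add: power_0_left if_distrib cong: if_cong)
  then show ?thesis by (simp add: shifted_jacobi_def poly_sum)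
qed

lemma degree_shifted_jacobi: "degree (shifted_jacobi n a b) \<le> n"
proof -
  have "degree (smult c (Y ^ l)) \<le> n" if "l \<le> n" for c l
    using degree_smult_le[of c "Y ^ l"] degree_power_le[of Y l] that by simp
  then show ?thesis
    unfolding shifted_jacobi_def by (intro order.trans[OF degree_smult_le degree_sum_le]) auto
qed

text \<open>The parameter \<beta> + 1 exceeds that of the weight by one, so orthogonality needs a
  factor x in the test polynomial and fails only at k = 0. Expanding in powers of 1 - x leaves a
  Vandermonde sum with factor \<open>pochhammer (- real (n - k)) n\<close>.\<close>

lemma L_shifted_jacobi:
  assumes "k \<le> n"
  shows "L (X ^ k * Y ^ (n - k) * shifted_jacobi n \<alpha> (\<beta> + 1)) =
    (if k = 0 then (-1) ^ n * K * pochhammer (\<alpha> + 1) n / pochhammer (\<alpha> + \<beta> + 2) n else 0)"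
proof -
  have pos: "pochhammer (\<alpha> + 1) m > 0" "pochhammer (\<alpha> + \<beta> + 2) m > 0" for m
    using \<alpha> \<beta> by (auto intro!: pochhammer_pos)
  have "L (X ^ k * Y ^ (n - k) * shifted_jacobi n \<alpha> (\<beta> + 1)) =
    pochhammer (\<alpha> + 1) n / fact n * (\<Sum>l\<le>n. pochhammer (- real n) l * pochhammer (real n + \<alpha> + (\<beta> + 1) + 1) l
        / (pochhammer (\<alpha> + 1) l * fact l) * L (X ^ k * Y ^ (n - k + l)))"
    unfolding shifted_jacobi_def mult_smult_right L_smult sum_distrib_left L_sum
    by (simp only: power_add mult.assoc)
  also have "\<dots> = pochhammer (\<alpha> + 1) n / fact n * (K * pochhammer (\<beta> + 1) k / pochhammer (\<alpha> + \<beta> + 2) n *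
     (\<Sum>l\<le>n. pochhammer (- real n) l / fact l * (pochhammer (\<alpha> + 1) (l + (n - k)) / pochhammer (\<alpha> + 1) l)))"
    unfolding sum_distrib_left
  proof (intro sum.cong refl)
    fix l
    \<comment> \<open>The denominator of the moment has index k + (n - k) + l = n + l; its part
      beyond n cancels the second Pochhammer factor of the Jacobi coefficient.\<close>
    have "pochhammer (\<alpha> + \<beta> + 2) (k + (n - k + l))
            = pochhammer (\<alpha> + \<beta> + 2) n * pochhammer (real n + \<alpha> + (\<beta> + 1) + 1) l"
      using assms pochhammer_product'[of "\<alpha> + \<beta> + 2" n l] by (simp add: add_ac)
    moreover from this have "pochhammer (real n + \<alpha> + (\<beta> + 1) + 1) l \<noteq> 0"
      using pos(2) by (metis mult_zero_right less_irrefl)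
    ultimately show "pochhammer (\<alpha> + 1) n / fact n * (pochhammer (- real n) l * pochhammer (real n + \<alpha> + (\<beta> + 1) + 1) l
        / (pochhammer (\<alpha> + 1) l * fact l) * L (X ^ k * Y ^ (n - k + l))) =
      pochhammer (\<alpha> + 1) n / fact n * (K * pochhammer (\<beta> + 1) k / pochhammer (\<alpha> + \<beta> + 2) n *
      (pochhammer (- real n) l / fact l * (pochhammer (\<alpha> + 1) (l + (n - k)) / pochhammer (\<alpha> + 1) l)))"
      by (simp only: L_moment) (simp add: add.commute[of l] mult_ac)
  qed
  also have "\<dots> = K * pochhammer (\<beta> + 1) k * pochhammer (\<alpha> + 1) (n - k) * pochhammer (- real (n - k)) n
                    / (fact n * pochhammer (\<alpha> + \<beta> + 2) n)"
    using \<alpha> pos(1)[of n] by (subst pochhammer_quotient_sum) auto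
  also have "\<dots> = (if k = 0 then (-1) ^ n * K * pochhammer (\<alpha> + 1) n / pochhammer (\<alpha> + \<beta> + 2) n else 0)"
  proof (cases "k = 0")
    case False
    then have "pochhammer (- real (n - k)) n = 0"
      using assms by (intro pochhammer_of_nat_eq_0_lemma) simp
    then show ?thesis using False by (simp only:) simp
  qed (simp add: pochhammer_same)
  finally show ?thesis .
qed

text \<open>\<open>S n\<close> is a multiple of the shifted Jacobi polynomial with parameters \<open>\<alpha> + 1\<close>, \<open>\<beta>\<close>, written in
  the Bernstein basis. Up to a constant factor it represents the evaluation at \<open>1\<close> on polynomials of degree at most \<open>n\<close>.\<close>

definition S :: "nat \<Rightarrow> real poly" where
  "S n = (\<Sum>k\<le>n. smult (pochhammer (- real n) k / (fact k * pochhammer (\<alpha> + 2) (n - k) * pochhammer (\<beta> + 1) k))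
                   (X ^ k * Y ^ (n - k)))"

lemma L_S_mult: "L (S n * p) = (\<Sum>k\<le>n. pochhammer (- real n) k /
    (fact k * pochhammer (\<alpha> + 2) (n - k) * pochhammer (\<beta> + 1) k) * L (X ^ k * Y ^ (n - k) * p))"
  unfolding S_def sum_distrib_right mult_smult_left L_sum L_smult ..

text \<open>The extra factor 1 - x turns the moment factor into (\<alpha> + 1) times
  \<open>pochhammer (\<alpha> + 2) (n - k)\<close>, which cancels against the coefficient of
  \<open>S n\<close>. The remaining Vandermonde sum vanishes because j < n.\<close>

lemma L_S_orthogonal:
  assumes "j < n"
  shows "L (S n * (Y * X ^ j)) = 0"
proof -
  \<comment> \<open>Here p plays the role of \<open>pochhammer (\<alpha> + 2) (n - k)\<close>, and
    b, b' are the Pochhammer symbols of \<beta> + 1 with indices k and k + j.\<close>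
  have cancel: "c / (f * p * b) * (M * b' * (a * p) / t) = M * a / t * (c / f * (b' / b))"
    if "p \<noteq> 0" for a b b' c f M p t :: real
    using that by (simp add: mult_ac)
  have "L (S n * (Y * X ^ j)) = (\<Sum>k\<le>n. K * (\<alpha> + 1) / pochhammer (\<alpha> + \<beta> + 2) (n + j + 1) *
      (pochhammer (- real n) k / fact k * (pochhammer (\<beta> + 1) (k + j) / pochhammer (\<beta> + 1) k)))"
    unfolding L_S_mult
  proof (intro sum.cong refl)
    fix k assume "k \<in> {..n}"
    have "pochhammer (\<alpha> + 2) (n - k) > 0" using \<alpha> by (intro pochhammer_pos) simp
    have "X ^ k * Y ^ (n - k) * (Y * X ^ j) = X ^ (k + j) * Y ^ Suc (n - k)"
      by (simp only: power_add power_Suc mult_ac)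
    moreover have "k + j + Suc (n - k) = n + j + 1"
      using \<open>k \<in> {..n}\<close> by simp
    moreover have "pochhammer (\<alpha> + 1) (Suc (n - k)) = (\<alpha> + 1) * pochhammer (\<alpha> + 2) (n - k)"
      by (simp only: pochhammer_rec add.assoc one_add_one)
    ultimately have L: "L (X ^ k * Y ^ (n - k) * (Y * X ^ j)) = K * pochhammer (\<beta> + 1) (k + j) *
        ((\<alpha> + 1) * pochhammer (\<alpha> + 2) (n - k)) / pochhammer (\<alpha> + \<beta> + 2) (n + j + 1)"
      by (simp only: L_moment)
    show "pochhammer (- real n) k / (fact k * pochhammer (\<alpha> + 2) (n - k) * pochhammer (\<beta> + 1) k)
        * L (X ^ k * Y ^ (n - k) * (Y * X ^ j)) = K * (\<alpha> + 1) / pochhammer (\<alpha> + \<beta> + 2) (n + j + 1) *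
      (pochhammer (- real n) k / fact k * (pochhammer (\<beta> + 1) (k + j) / pochhammer (\<beta> + 1) k))"
      unfolding L by (rule cancel) (use \<open>pochhammer (\<alpha> + 2) (n - k) > 0\<close> in simp)
  qed
  also have "\<dots> = 0"
    unfolding sum_distrib_left[symmetric] using \<beta> assms
    by (subst pochhammer_quotient_sum) (auto simp: pochhammer_of_nat_eq_0_lemma)
  finally show ?thesis .
qed

text \<open>The difference p - p(1) is (1 - x) q with q zero or of degree below n, hence orthogonal
  to \<open>S n\<close>. The constant \<open>L (S n)\<close> stays unevaluated and is eliminated
  later.\<close>

lemma L_S_eval:
  assumes "degree p \<le> n"
  shows "L (S n * p) = poly p 1 * L (S n)"
proof -
  have "poly (p - [:poly p 1:]) 1 = 0" by simp
  then have "[:-1, 1:] dvd p - [:poly p 1:]" by (simp only: poly_eq_0_iff_dvd)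
  then obtain r where r: "p - [:poly p 1:] = [:-1, 1:] * r" by (elim dvdE)
  define q where "q = - r"
  have q: "p - [:poly p 1:] = Y * q" using r by (simp add: q_def)
  have "L (S n * (Y * q)) = 0"
  proof (cases "q = 0")
    case False
    have "degree (Y * q) = Suc (degree q)" using False by (subst degree_mult_eq) auto
    moreover have "degree (Y * q) \<le> n" unfolding q[symmetric] using assms by (intro degree_diff_le) auto
    ultimately have deg: "degree q < n" by simp
    have "q = (\<Sum>j\<le>degree q. smult (coeff q j) (X ^ j))"
      using poly_as_sum_of_monoms[of q] by (simp add: monom_altdef)
    then have "L (S n * (Y * q)) = L (S n * (Y * (\<Sum>j\<le>degree q. smult (coeff q j) (X ^ j))))"
      by (rule arg_cong)
    also have "\<dots> = (\<Sum>j\<le>degree q. coeff q j * L (S n * (Y * X ^ j)))"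
      by (simp only: sum_distrib_left mult_smult_right L_sum L_smult)
    also have "\<dots> = 0" using deg by (intro sum.neutral ballI) (subst L_S_orthogonal, auto)
    finally show ?thesis .
  qed simp
  moreover have "S n * p = S n * (Y * q) + smult (poly p 1) (S n)"
    unfolding q[symmetric] by (simp add: right_diff_distrib)
  ultimately show ?thesis by (simp only: L_add L_smult)
qed

section \<open>Values of the dual Bernstein polynomials at 1\<close>

text \<open>Pairing \<open>S n\<close> with a dual polynomial reads off one coefficient of
  \<open>S n\<close>; the binomial hidden in \<open>pochhammer (- real n) i / fact i\<close> cancels
  the one from the duality.\<close>

lemma poly_dual_bernstein_1_L_S:
  assumes "i \<le> n"
  shows "poly (dual_bernstein n \<alpha> \<beta> i) 1 * L (S n) = (-1) ^ i / (pochhammer (\<alpha> + 2) (n - i) * pochhammer (\<beta> + 1) i)"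
proof -
  have "pochhammer (- real n) i / fact i = (-1) ^ i * real (n choose i)"
    by (simp add: binomial_gbinomial gbinomial_pochhammer)
  moreover have "poly (dual_bernstein n \<alpha> \<beta> i) 1 * L (S n) = (\<Sum>k\<le>n. pochhammer (- real n) k /
    (fact k * pochhammer (\<alpha> + 2) (n - k) * pochhammer (\<beta> + 1) k) * (if k = i then 1 / real (n choose i) else 0))"
    unfolding L_S_eval[OF degree_dual_bernstein[OF assms], symmetric] L_S_mult
    by (intro sum.cong refl) (simp only: L_dual_bernstein[OF assms] atMost_iff)
  ultimately show ?thesis using assms by (simp add: if_distrib field_simps cong: if_cong)
qed

text \<open>The case i = 0 fixes the common scale: the dual polynomial of index 0 and the Jacobi
  polynomial are both orthogonal to the test polynomials with k \<ge> 1, hence proportional.\<close>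

lemma poly_dual_bernstein_0_1:
  "poly (dual_bernstein n \<alpha> \<beta> 0) 1 = (-1) ^ n * pochhammer (\<alpha> + \<beta> + 2) n / (K * fact n)"
proof -
  \<comment> \<open>This is the pairing of the Jacobi polynomial with (1 - x)^n, the case k = 0 of
    \<open>L_shifted_jacobi\<close>.\<close>
  define c where "c = (-1) ^ n * K * pochhammer (\<alpha> + 1) n / pochhammer (\<alpha> + \<beta> + 2) n"
  have pos: "pochhammer (\<alpha> + 1) n > 0" "pochhammer (\<alpha> + \<beta> + 2) n > 0"
    using \<alpha> \<beta> by (auto intro!: pochhammer_pos)
  have "c \<noteq> 0" using pos K_pos by (simp add: c_def)
  have "dual_bernstein n \<alpha> \<beta> 0 - smult (1 / c) (shifted_jacobi n \<alpha> (\<beta> + 1)) = 0"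
  proof (rule orthogonal_imp_0)
    show "degree (dual_bernstein n \<alpha> \<beta> 0 - smult (1 / c) (shifted_jacobi n \<alpha> (\<beta> + 1))) \<le> n"
      by (intro degree_diff_le degree_dual_bernstein order.trans[OF degree_smult_le] degree_shifted_jacobi) simp
    fix k assume "k \<le> n"
    then show "L (X ^ k * Y ^ (n - k) * (dual_bernstein n \<alpha> \<beta> 0 - smult (1 / c) (shifted_jacobi n \<alpha> (\<beta> + 1)))) = 0"
      using \<open>c \<noteq> 0\<close>
      by (simp only: right_diff_distrib mult_smult_right L_diff L_smult L_dual_bernstein L_shifted_jacobi c_def[symmetric]) simp
  qed
  then have "poly (dual_bernstein n \<alpha> \<beta> 0) 1 = poly (shifted_jacobi n \<alpha> (\<beta> + 1)) 1 / c"
    by simp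
  then show ?thesis
    using pos K_pos by (cases "even n") (auto simp: poly_shifted_jacobi_1 c_def field_simps)
qed

lemma poly_dual_bernstein_1:
  assumes "i \<le> n"
  shows "poly (dual_bernstein n \<alpha> \<beta> i) 1 = (-1) ^ (n - i) * pochhammer (\<alpha> + \<beta> + 2) n * pochhammer (\<alpha> + 2) n
     / (K * fact n * pochhammer (\<alpha> + 2) (n - i) * pochhammer (\<beta> + 1) i)"
proof -
  have pos: "pochhammer (\<alpha> + 2) n > 0" using \<alpha> by (auto intro!: pochhammer_pos)
  let ?d = "poly (dual_bernstein n \<alpha> \<beta> 0) 1"
  \<comment> \<open>The case i = 0 determines \<open>L (S n)\<close>; inserting this 1 removes it
    from the formula for general i.\<close>
  have L0: "?d * L (S n) * pochhammer (\<alpha> + 2) n = 1"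
    using pos by (simp only: poly_dual_bernstein_1_L_S[OF le0]) simp
  have "poly (dual_bernstein n \<alpha> \<beta> i) 1 = poly (dual_bernstein n \<alpha> \<beta> i) 1 * (?d * L (S n) * pochhammer (\<alpha> + 2) n)"
    unfolding L0 by simp
  also have "\<dots> = (poly (dual_bernstein n \<alpha> \<beta> i) 1 * L (S n)) * ?d * pochhammer (\<alpha> + 2) n"
    by (simp only: mult_ac)
  also have "\<dots> = ((-1) ^ i * (-1) ^ n) * pochhammer (\<alpha> + \<beta> + 2) n * pochhammer (\<alpha> + 2) n
     / (K * fact n * pochhammer (\<alpha> + 2) (n - i) * pochhammer (\<beta> + 1) i)"
    unfolding poly_dual_bernstein_1_L_S[OF assms] poly_dual_bernstein_0_1 by (simp add: mult_ac)
  also have "(-1) ^ i * (-1) ^ n = ((-1) ^ (n - i) :: real)"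
    using assms by (simp add: minus_one_power_iff)
  finally show ?thesis .
qed

section \<open>The two halves of the identity: test polynomials and the value at 1\<close>

text \<open>After integration by parts only Kronecker deltas remain. For j + 1 = i the factor
  \<alpha> + 1 + (n - i) is cancelled by the subtracted multiple of the dual polynomial, so only j =
  i contributes, as it does on the right.\<close>

lemma L_dual_bernstein_relation:
  assumes "i \<le> n" "j < n"
  shows "L (X ^ Suc j * Y ^ (n - Suc j) *
      (Y * pderiv (dual_bernstein n \<alpha> \<beta> i) - smult (real n - real i + \<alpha> + 1) (dual_bernstein n \<alpha> \<beta> i)))
    = (real i - real n) * (real i + \<beta> + 1) / (real i + 1)
      * L (X ^ Suc j * Y ^ (n - Suc j) * dual_bernstein n \<alpha> \<beta> (Suc i))"
proof -
  let ?D = "dual_bernstein n \<alpha> \<beta> i"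
  let ?e = "\<lambda>k. if k = i then 1 / real (n choose i) else 0"
  have 1: "X ^ Suc j * Y ^ (n - Suc j) * (Y * pderiv ?D) = X ^ Suc j * Y ^ Suc (n - Suc j) * pderiv ?D"
    by (simp only: power_Suc mult_ac)
  have 2: "Suc (n - Suc j) = n - j" using assms by simp
  have lhs: "L (X ^ Suc j * Y ^ (n - Suc j) * (Y * pderiv ?D - smult (real n - real i + \<alpha> + 1) ?D))
      = (\<alpha> + 1 + real (n - Suc j)) * ?e (Suc j) - (\<beta> + 1 + real j) * ?e j
        - (real n - real i + \<alpha> + 1) * ?e (Suc j)"
    unfolding right_diff_distrib[of "_ * _"] 1 L_diff L_pderiv mult_smult_right L_smult
    unfolding 2 using assms by (simp only: L_dual_bernstein Suc_leI less_imp_le)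
  \<comment> \<open>For i = n the polynomial of index n + 1 is 0 by convention, in agreement with j
    < n ruling out j = i.\<close>
  have rhs: "L (X ^ Suc j * Y ^ (n - Suc j) * dual_bernstein n \<alpha> \<beta> (Suc i))
      = (if j = i then 1 / real (n choose Suc i) else 0)"
  proof (cases "Suc i \<le> n")
    case True
    then show ?thesis using assms by (simp only: L_dual_bernstein Suc_leI nat.inject)
  next
    case False
    then show ?thesis using assms by (simp add: dual_bernstein_def)
  qed
  show ?thesis
  proof (cases "j = i")
    case True
    with assms have "Suc i \<le> n" by simp
    then have pos: "real (n choose i) > 0" "real (n choose Suc i) > 0"
      by simp_all
    \<comment> \<open>This binomial identity relates the two normalisations and produces the factor
      (n - i)/(i + 1).\<close>
    have "Suc i * (n choose Suc i) = (n - i) * (n choose i)"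
      by (simp only: binomial_absorption binomial_absorb_comp)
    then have "real (Suc i * (n choose Suc i)) = real ((n - i) * (n choose i))"
      by (rule arg_cong)
    then have "real (n choose Suc i) * (real i + 1) = (real n - real i) * real (n choose i)"
      using \<open>i \<le> n\<close> by (simp only: of_nat_mult of_nat_diff of_nat_Suc mult_ac add_ac)
    then have "1 / real (n choose i) = (real n - real i) / ((real i + 1) * real (n choose Suc i))"
      using pos by (simp add: divide_simps mult_ac)
    moreover define d where "d = real n - real i"
    ultimately have inv: "1 / real (n choose i) = d / ((real i + 1) * real (n choose Suc i))"
      by simp
    have "real i - real n = - d" by (simp add: d_def)
    then show ?thesis
      unfolding lhs rhs using True by (simp only: if_True if_False n_not_Suc_n[symmetric] inv) (simp add: add_ac)
  next
    case False
    then show ?thesis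
      unfolding lhs rhs using assms by (auto simp: algebra_simps of_nat_diff add_divide_distrib)
  qed
qed

text \<open>At x = 1 the derivative term drops out. Both terms on the left are multiples of the same
  quantity \<open>G\<close>, with factors 1 and (n - i)/(i + 1), whose sum (n + 1)/(i + 1) accounts
  for the n + 1 in \<open>coeff_A\<close>.\<close>

lemma dual_bernstein_relation_at_1:
  assumes "i \<le> n"
  shows "(real n - real i + \<alpha> + 1) * poly (dual_bernstein n \<alpha> \<beta> i) 1
      + (real i - real n) * (real i + \<beta> + 1) / (real i + 1) * poly (dual_bernstein n \<alpha> \<beta> (Suc i)) 1
    = coeff_A \<alpha> \<beta> n i * ((real n + \<alpha> + 1) / (real i + 1)) * poly (shifted_jacobi n \<alpha> (\<beta> + 1)) 1"
proof -
  define m where "m = n - i"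
  define F where "F = (-1) ^ m * pochhammer (\<alpha> + \<beta> + 2) n / (K * fact n * pochhammer (\<beta> + 1) i)"
  define P where "P = pochhammer (\<alpha> + 2) n"
  have n: "real n = real m + real i" using assms by (simp add: m_def)
  \<comment> \<open>These two relations trade Pochhammer symbols based at \<alpha> + 2, from the
    values at 1, for those based at \<alpha> + 1 in \<open>coeff_A\<close> and in the Jacobi
    value.\<close>
  have P1: "pochhammer (\<alpha> + 1) n * (\<alpha> + 1 + real n) = (\<alpha> + 1) * P"
    using pochhammer_rec[of "\<alpha> + 1" n] by (simp add: P_def pochhammer_Suc add.assoc)
  have m1: "pochhammer (\<alpha> + 1) m * (\<alpha> + 1 + real m) = (\<alpha> + 1) * pochhammer (\<alpha> + 2) m"
    using pochhammer_rec[of "\<alpha> + 1" m] by (simp add: pochhammer_Suc add.assoc)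
  have pos: "pochhammer (\<alpha> + 1) m > 0" "pochhammer (\<alpha> + 2) m > 0" "\<alpha> + 1 > 0" "\<alpha> + 1 + real m > 0"
      "pochhammer (\<beta> + 1) i > 0" "\<beta> + 1 + real i > 0"
    using \<alpha> \<beta> by (auto intro!: pochhammer_pos)
  have Di: "poly (dual_bernstein n \<alpha> \<beta> i) 1 = F * P / pochhammer (\<alpha> + 2) m"
    unfolding poly_dual_bernstein_1[OF assms] F_def P_def m_def by simp
  define G where "G = F * P * (\<alpha> + 1 + real m) / pochhammer (\<alpha> + 2) m"
  have G: "(real n - real i + \<alpha> + 1) * poly (dual_bernstein n \<alpha> \<beta> i) 1 = G"
    unfolding Di G_def n by (simp add: add_ac)
  \<comment> \<open>The closed form needs i + 1 \<le> n, that is m > 0; for m = 0 the coefficient i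
    - n vanishes.\<close>
  have Dj: "(real i + \<beta> + 1) * poly (dual_bernstein n \<alpha> \<beta> (Suc i)) 1
      = - (F * P * (\<alpha> + 1 + real m) / pochhammer (\<alpha> + 2) m)" if "m > 0"
  proof -
    have m: "m = Suc (n - Suc i)" "Suc i \<le> n" using that by (auto simp: m_def)
    define l where "l = n - Suc i"
    have ml: "m = Suc l" using m l_def by simp
    have lm: "pochhammer (\<alpha> + 2) m = pochhammer (\<alpha> + 2) l * (\<alpha> + 1 + real m)"
      unfolding ml by (simp add: pochhammer_Suc algebra_simps)
    have "(-1) ^ m = - ((-1) ^ l :: real)" unfolding ml by simp
    then show ?thesis
      unfolding poly_dual_bernstein_1[OF m(2)] F_def P_def lm l_def[symmetric]
      using pos(4,6) by (simp add: pochhammer_Suc add_ac)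
  qed
  have "(real i - real n) * (real i + \<beta> + 1) / (real i + 1) * poly (dual_bernstein n \<alpha> \<beta> (Suc i)) 1
      = (real i - real n) / (real i + 1) * ((real i + \<beta> + 1) * poly (dual_bernstein n \<alpha> \<beta> (Suc i)) 1)"
    by simp
  also have "\<dots> = real m / (real i + 1) * G"
  proof (cases "m > 0")
    case True
    show ?thesis unfolding Dj[OF True] G_def n by simp
  qed (simp add: n)
  finally have "(real n - real i + \<alpha> + 1) * poly (dual_bernstein n \<alpha> \<beta> i) 1
      + (real i - real n) * (real i + \<beta> + 1) / (real i + 1) * poly (dual_bernstein n \<alpha> \<beta> (Suc i)) 1
      = (1 + real m / (real i + 1)) * G"
    unfolding G by (simp only: distrib_right mult_1)
  also have "G = F * P * ((\<alpha> + 1 + real m) / pochhammer (\<alpha> + 2) m)"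
    by (simp add: G_def)
  also have "1 + real m / (real i + 1) = (real n + 1) / (real i + 1)"
    unfolding n by (simp add: field_simps)
  also have "(\<alpha> + 1 + real m) / pochhammer (\<alpha> + 2) m = (\<alpha> + 1) / pochhammer (\<alpha> + 1) m"
    using m1 pos by (simp add: frac_eq_eq mult_ac)
  also have "F * P * ((\<alpha> + 1) / pochhammer (\<alpha> + 1) m)
      = F / pochhammer (\<alpha> + 1) m * (pochhammer (\<alpha> + 1) n * (\<alpha> + 1 + real n))"
    unfolding P1 by simp
  also have "(real n + 1) / (real i + 1) * \<dots>
      = coeff_A \<alpha> \<beta> n i * ((real n + \<alpha> + 1) / (real i + 1)) * poly (shifted_jacobi n \<alpha> (\<beta> + 1)) 1"
  proof -
    have "\<alpha> + \<beta> + 1 + 1 = \<alpha> + \<beta> + 2" "\<alpha> + 1 + real n = real n + \<alpha> + 1" by simp_all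
    then show ?thesis
      unfolding coeff_A_def poly_shifted_jacobi_1 F_def m_def[symmetric] K_def[symmetric]
      by (simp only: times_divide_eq_left times_divide_eq_right divide_divide_eq_left mult_ac)
  qed
  finally show ?thesis .
qed

end

theorem theorem3p2:
  fixes \<alpha> \<beta> :: real and n i :: nat
  assumes "\<alpha> > -1" and "\<beta> > -1" and "i \<le> n"
  shows "[:1, -1:] * pderiv (dual_bernstein n \<alpha> \<beta> i)
           - smult (real n - real i + \<alpha> + 1) (dual_bernstein n \<alpha> \<beta> i)
         = smult ((real i - real n) * (real i + \<beta> + 1) / (real i + 1)) (dual_bernstein n \<alpha> \<beta> (i + 1))
           - smult (coeff_A \<alpha> \<beta> n i * ((real n + \<alpha> + 1) / (real i + 1))) (shifted_jacobi n \<alpha> (\<beta> + 1))"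
proof -
  interpret jacobi_weight \<alpha> \<beta> using assms by unfold_locales
  let ?D = "dual_bernstein n \<alpha> \<beta>" and ?R = "shifted_jacobi n \<alpha> (\<beta> + 1)"
  let ?b = "(real i - real n) * (real i + \<beta> + 1) / (real i + 1)"
  let ?a = "coeff_A \<alpha> \<beta> n i * ((real n + \<alpha> + 1) / (real i + 1))"
  have deg_D: "degree (?D k) \<le> n" for k
    using degree_dual_bernstein[of k n] by (cases "k \<le> n") (auto simp: dual_bernstein_def)
  have deg: "degree (Y * pderiv (?D i)) \<le> n"
  \<comment> \<open>Differentiation lowers the degree by one and \<open>Y\<close> raises it again; a
    constant is separate because its degree cannot drop below 0.\<close>
  proof (cases "degree (?D i) = 0")
    case True
    then have "pderiv (?D i) = 0" by (simp add: pderiv_eq_0_iff)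
    then show ?thesis by simp
  next
    case False
    have "degree (Y * pderiv (?D i)) \<le> degree Y + degree (pderiv (?D i))" by (rule degree_mult_le)
    also have "\<dots> \<le> n" using False deg_D[of i] by (simp add: degree_pderiv)
    finally show ?thesis .
  qed
  have "Y * pderiv (?D i) - smult (real n - real i + \<alpha> + 1) (?D i) - (smult ?b (?D (Suc i)) - smult ?a ?R) = 0"
  proof (rule orthogonal_vanishing_imp_0)
    show "degree (Y * pderiv (?D i) - smult (real n - real i + \<alpha> + 1) (?D i)
            - (smult ?b (?D (Suc i)) - smult ?a ?R)) \<le> n"
      by (intro degree_diff_le deg order.trans[OF degree_smult_le deg_D]
          order.trans[OF degree_smult_le degree_shifted_jacobi])
    show "poly (Y * pderiv (?D i) - smult (real n - real i + \<alpha> + 1) (?D i)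
            - (smult ?b (?D (Suc i)) - smult ?a ?R)) 1 = 0"
      unfolding poly_diff poly_mult poly_smult
      using dual_bernstein_relation_at_1[OF \<open>i \<le> n\<close>] by simp
    fix k assume "k < n"
    \<comment> \<open>The exponent of x is positive, so the Jacobi term is invisible to these test
      polynomials and matters only at x = 1.\<close>
    then have "L (X ^ Suc k * Y ^ (n - Suc k) * ?R) = 0"
      by (subst L_shifted_jacobi) auto
    then show "L (X ^ Suc k * Y ^ (n - Suc k) * (Y * pderiv (?D i) - smult (real n - real i + \<alpha> + 1) (?D i)
            - (smult ?b (?D (Suc i)) - smult ?a ?R))) = 0"
      unfolding right_diff_distrib[of "X ^ Suc k * Y ^ (n - Suc k)" "_ - _" "_ - _"]
        right_diff_distrib[of "X ^ Suc k * Y ^ (n - Suc k)" "smult ?b _"] L_diff mult_smult_right L_smult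
        L_dual_bernstein_relation[OF \<open>i \<le> n\<close> \<open>k < n\<close>]
      by (simp only: mult_zero_right diff_zero diff_self)
  qed
  then show ?thesis by simp
qed

end
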